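(* Let $m\ge1$ and $d\ge4$ be integers with $d$ even, $2m-1>\sqrt{d-1}$ and $m\le d/2$. Then there is $N$ such that for all $n\ge N$, a random graph $G$ drawn from $\mathcal{G}_{n,d}$ satisfies $\lambda_2(G)>2\sqrt{d-1}$ with probability at least $n^{1-m}-\tfrac12 n^{2-2m}$.
   Context: $\mathcal{G}_{n,d}$: choose $d/2$ independent uniformly random permutations $\pi_1,\dots,\pi_{d/2}$ of $\{1,\dots,n\}$; $G$ is the $d$-regular multigraph on $\{1,\dots,n\}$ with adjacency matrix $A=\sum_{j=1}^{d/2}(P_{\pi_j}+P_{\pi_j}^{-1})$, $P_\pi$ the permutation matrix of $\pi$. Its eigenvalues are $\lambda_1(G)=d\ge\lambda_2(G)\ge\cdots\ge\lambda_n(G)$. *)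

theory Defs
  imports
    "HOL-Probability.Probability"
    "Jordan_Normal_Form.Char_Poly"
begin

(* Vertices are numbered from 0, following the index convention of matrices: the vertex set
   is {0..<n} in place of {1..n}. *)

definition perm_matrix :: "nat \<Rightarrow> (nat \<Rightarrow> nat) \<Rightarrow> real mat" where
  "perm_matrix n p = Matrix.mat n n (\<lambda>(u, v). if p u = v then 1 else 0)"

(* The next lemma justifies writing the inverse of a permutation matrix as the matrix of the
   inverse permutation. *)

lemma perm_matrix_inverse:
  assumes p: "p permutes {0..<n}"
  shows "inverts_mat (perm_matrix n p) (perm_matrix n (Hilbert_Choice.inv p))"
    and "inverts_mat (perm_matrix n (Hilbert_Choice.inv p)) (perm_matrix n p)"
proof -
  have main: "perm_matrix n q * perm_matrix n (Hilbert_Choice.inv q) = 1\<^sub>m n"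
    if q: "q permutes {0..<n}" for q
  proof (rule eq_matI)
    fix u v assume "u < dim_row (1\<^sub>m n :: real mat)" "v < dim_col (1\<^sub>m n :: real mat)"
    then have uv: "u < n" "v < n" by auto
    then have qu: "q u < n" using permutes_in_image[OF q, of u] by simp
    have "(perm_matrix n q * perm_matrix n (Hilbert_Choice.inv q)) $$ (u, v)
        = (\<Sum>w\<in>{0..<n}. (if q u = w then 1 else 0) * (if Hilbert_Choice.inv q w = v then 1 else 0))"
      using uv by (simp add: perm_matrix_def scalar_prod_def)
    also have "\<dots> = (\<Sum>w\<in>{0..<n}. if q u = w then (if Hilbert_Choice.inv q w = v then 1 else 0) else 0)"
      by (intro sum.cong) auto
    also have "\<dots> = (if Hilbert_Choice.inv q (q u) = v then 1 else 0)"
      using qu by (subst sum.delta') auto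
    also have "\<dots> = (1\<^sub>m n :: real mat) $$ (u, v)"
      using uv permutes_inverses(2)[OF q] by simp
    finally show "(perm_matrix n q * perm_matrix n (Hilbert_Choice.inv q)) $$ (u, v) = 1\<^sub>m n $$ (u, v)" .
  qed (simp_all add: perm_matrix_def)
  show "inverts_mat (perm_matrix n p) (perm_matrix n (Hilbert_Choice.inv p))"
    using main[OF p] by (simp add: inverts_mat_def perm_matrix_def)
  show "inverts_mat (perm_matrix n (Hilbert_Choice.inv p)) (perm_matrix n p)"
    using main[OF permutes_inv[OF p]] permutes_inv_inv[OF p]
    by (simp add: inverts_mat_def perm_matrix_def)
qed

definition adjacency_of_perms :: "nat \<Rightarrow> nat \<Rightarrow> (nat \<Rightarrow> nat \<Rightarrow> nat) \<Rightarrow> real mat" where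
  "adjacency_of_perms n d \<pi> = Matrix.mat n n (\<lambda>(u, v).
     \<Sum>j = 1..d div 2. (perm_matrix n (\<pi> j) + perm_matrix n (Hilbert_Choice.inv (\<pi> j))) $$ (u, v))"

(* Independent uniformly random permutations, indexed by {1..d div 2}; the second argument of
   Pi_pmf is only the dummy value outside this index set. *)

definition random_perms :: "nat \<Rightarrow> nat \<Rightarrow> (nat \<Rightarrow> nat \<Rightarrow> nat) pmf" where
  "random_perms n d = Pi_pmf {1..d div 2} id (\<lambda>_. pmf_of_set {p. p permutes {0..<n}})"

(* The multigraph G is represented by its adjacency matrix, so that the model is a distribution
   on matrices. *)

definition random_regular_graph :: "nat \<Rightarrow> nat \<Rightarrow> real mat pmf" where
  "random_regular_graph n d = map_pmf (adjacency_of_perms n d) (random_perms n d)"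

(* Eigenvalues with algebraic multiplicity in decreasing order. For symmetric real matrices of
   size n, such as adjacency matrices, all n roots of the characteristic polynomial are real. *)

definition eigenvalues_desc :: "real mat \<Rightarrow> real list" where
  "eigenvalues_desc A = rev (sorted_list_of_multiset (proots (char_poly A)))"

(* The k-th largest eigenvalue, counted from k = 1. *)

definition lambda :: "nat \<Rightarrow> real mat \<Rightarrow> real" where
  "lambda k A = eigenvalues_desc A ! (k - 1)"

end

theory Submission
  imports Defs "Jordan_Normal_Form.Schur_Decomposition"
begin

text \<open>If the first \<open>m\<close> permutations preserve a set \<open>S\<close> of one or two vertices, put \<open>s = 2 m - 1\<close> and
  consider \<open>f x = s powr - dist(x, S)\<close>. It satisfies \<open>A f \<ge> (s + (d - 1) / s) f\<close> pointwise, and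
  \<open>s + (d - 1) / s > 2 sqrt (d - 1)\<close> because \<open>s > sqrt (d - 1)\<close>. Truncated at a large fixed radius, \<open>f\<close>
  still has Rayleigh quotient above \<open>2 sqrt (d - 1)\<close>, and for large \<open>n\<close> it is nearly orthogonal to the
  constant eigenvector, whence \<open>\<lambda>\<^sub>2 > 2 sqrt (d - 1)\<close>.

  The first two Bonferroni terms for the events that some vertex is fixed by the first \<open>m\<close> permutations
  fall slightly short of the claim, since \<open>(n (n - 1)) powr (1 - m)\<close> exceeds \<open>n powr (2 - 2 m)\<close>.
  This is why the events that a pair of vertices is swapped by all these permutations are added.\<close>

subsection \<open>Diagonalization of real symmetric matrices\<close>

text \<open>The reflection along \<open>w = v / |v| - e_0\<close> exchanges the unit vectors
  \<open>v / |v|\<close> and \<open>e_0\<close>. As a symmetric involution it preserves symmetry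
  under conjugation, so it can be used to split off an eigenvector.\<close>

lemma householder_reflection:
  fixes v :: "real vec"
  assumes v: "v \<in> carrier_vec n" and v0: "v \<noteq> 0\<^sub>v n"
  obtains W c where "W \<in> carrier_mat n n" "transpose_mat W = W" "W * W = 1\<^sub>m n"
    "W *\<^sub>v unit_vec n 0 = c \<cdot>\<^sub>v v"
proof -
  have n: "n > 0" using v v0 by (cases n) auto
  define N where "N = sqrt (\<Sum>i<n. (v $ i)\<^sup>2)"
  have "\<exists>i<n. v $ i \<noteq> 0"
    using v v0 by (metis carrier_vecD eq_vecI index_zero_vec(1) index_zero_vec(2))
  then obtain k where k: "k < n" "v $ k \<noteq> 0" by blast
  have pos: "(\<Sum>i<n. (v $ i)\<^sup>2) > 0"
    by (rule sum_pos2[of _ k]) (use k in auto)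
  then have N: "N > 0" by (simp add: N_def)
  define u where "u i = v $ i / N" for i
  have uu: "(\<Sum>i<n. (u i)\<^sup>2) = 1"
    using pos by (simp add: u_def power_divide sum_divide_distrib[symmetric] N_def)
  define w where "w i = u i - (if i = 0 then 1 else 0)" for i
  define S where "S = (\<Sum>i<n. (w i)\<^sup>2)"
  \<comment> \<open>Since \<open>u\<close> has norm 1, this gives \<open>w 0 = - S / 2\<close>,
    which turns column 0 of \<open>W\<close> into \<open>u\<close>.\<close>
  have S: "S = 2 - 2 * u 0"
  proof -
    have "S = (\<Sum>i<n. (u i)\<^sup>2 + (if i = 0 then 1 - 2 * u i else 0))"
      unfolding S_def by (intro sum.cong) (auto simp: w_def power2_eq_square algebra_simps)
    also have "\<dots> = 1 + (1 - 2 * u 0)"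
      using n by (simp add: sum.distrib uu)
    finally show ?thesis by simp
  qed
  \<comment> \<open>If \<open>v\<close> is a positive multiple of the first unit vector then \<open>S = 0\<close>, and division by zero makes
    \<open>W\<close> the identity matrix.\<close>
  define W where "W = mat n n (\<lambda>(i, j). (if i = j then 1 else 0) - 2 * w i * w j / S)"
  show ?thesis
  proof
    show W: "W \<in> carrier_mat n n" by (simp add: W_def)
    show "transpose_mat W = W" by (rule eq_matI) (auto simp: W_def)
    show "W * W = 1\<^sub>m n"
    proof (rule eq_matI)
      fix i j assume "i < dim_row (1\<^sub>m n :: real mat)" "j < dim_col (1\<^sub>m n :: real mat)"
      then have ij: "i < n" "j < n" by auto
      have sq: "(\<Sum>l<n. c * (w l)\<^sup>2 / d) = c * S / d" for c d
        by (simp add: S_def sum_distrib_left sum_divide_distrib)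
      have "(W * W) $$ (i, j) = (\<Sum>l<n. ((if i = l then 1 else 0) - 2 * w i * w l / S) *
          ((if l = j then 1 else 0) - 2 * w l * w j / S))"
        using ij by (simp add: W_def scalar_prod_def lessThan_atLeast0)
      also have "\<dots> = (\<Sum>l<n. (if l = i then (if l = j then 1 else 0) - 2 * w l * w j / S else 0)
          - (if l = j then 2 * w i * w l / S else 0) + 4 * w i * w j * (w l)\<^sup>2 / S\<^sup>2)"
        by (intro sum.cong) (auto simp: algebra_simps power2_eq_square)
      also have "\<dots> = (if i = j then 1 else 0) - 4 * w i * w j / S + 4 * w i * w j * S / S\<^sup>2"
        using ij by (simp add: sum.distrib sum_subtractf sq)
      also have "\<dots> = (1\<^sub>m n :: real mat) $$ (i, j)"
        using ij by (simp add: power2_eq_square)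
      finally show "(W * W) $$ (i, j) = 1\<^sub>m n $$ (i, j)" .
    qed (simp_all add: W_def)
    show "W *\<^sub>v unit_vec n 0 = (1 / N) \<cdot>\<^sub>v v"
    proof (rule eq_vecI)
      fix i assume "i < dim_vec ((1 / N) \<cdot>\<^sub>v v)"
      then have i: "i < n" using v by simp
      have "S = 0 \<Longrightarrow> w i = 0"
        using i sum_nonneg_eq_0_iff[of "{..<n}" "\<lambda>i. (w i)\<^sup>2"] by (simp add: S_def)
      moreover have "w 0 = - S / 2" by (simp add: S w_def)
      ultimately have "W $$ (i, 0) = u i"
        using i n by (cases "S = 0") (auto simp: W_def w_def S field_simps)
      then show "(W *\<^sub>v unit_vec n 0) $ i = ((1 / N) \<cdot>\<^sub>v v) $ i"
        using i n v W by (simp add: u_def)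
    qed (use v W in auto)
  qed
qed

text \<open>Deflation along \<open>es\<close>: a reflection moves an eigenvector for the head to the
  first coordinate, symmetry clears the first row along with the first column, and induction handles
  the remaining block. The order of \<open>es\<close> is free, so the diagonal can later be taken in
  decreasing order.\<close>

theorem symmetric_mat_diagonalization:
  fixes A :: "real mat"
  assumes "A \<in> carrier_mat n n" "transpose_mat A = A"
    and "char_poly A = (\<Prod>e\<leftarrow>es. [:- e, 1:])"
  shows "\<exists>P \<in> carrier_mat n n. transpose_mat P * P = 1\<^sub>m n \<and>
    transpose_mat P * A * P = mat n n (\<lambda>(i, j). if i = j then es ! i else 0)"
  using assms
proof (induction es arbitrary: n A)
  case Nil
  then have "n = 0" using degree_monic_char_poly[OF Nil(1)] by simp
  then show ?case using Nil by (intro bexI[of _ "1\<^sub>m 0"]) (auto intro!: eq_matI)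
next
  case (Cons e es n A)
  note A = Cons.prems(1) and sym = Cons.prems(2)
  have ev: "eigenvalue A e"
    unfolding eigenvalue_root_char_poly[OF A] Cons.prems(3) by simp
  then obtain v where v: "v \<in> carrier_vec n" "v \<noteq> 0\<^sub>v n" "A *\<^sub>v v = e \<cdot>\<^sub>v v"
    using A unfolding eigenvalue_def eigenvector_def by auto
  have "n \<noteq> 0" using v by (metis carrier_vecD eq_vecI index_zero_vec(2) less_nat_zero_code)
  then obtain k where n: "n = Suc k" by (cases n) auto
  obtain W c where W: "W \<in> carrier_mat n n" "transpose_mat W = W" "W * W = 1\<^sub>m n"
    "W *\<^sub>v unit_vec n 0 = c \<cdot>\<^sub>v v"
    using householder_reflection[OF v(1,2)] .
  define A' where "A' = W * A * W"
  have A': "A' \<in> carrier_mat n n" using W A by (simp add: A'_def)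
  have sym': "transpose_mat A' = A'"
    using W A sym by (simp add: A'_def transpose_mult[of _ n n _ n] assoc_mult_mat[of _ n n _ n _ n])
  have "A' *\<^sub>v unit_vec n 0 = W *\<^sub>v (A *\<^sub>v (W *\<^sub>v unit_vec n 0))"
    using W A by (simp add: A'_def assoc_mult_mat_vec[of _ n n _ n])
  also have "\<dots> = e \<cdot>\<^sub>v (W *\<^sub>v (W *\<^sub>v unit_vec n 0))"
    using W(1) A v
    by (simp add: W(4) mult_mat_vec[of _ n n] smult_smult_assoc mult.commute)
  also have "\<dots> = e \<cdot>\<^sub>v unit_vec n 0"
    using assoc_mult_mat_vec[OF W(1) W(1) unit_vec_carrier[of n 0]] by (simp add: W(3))
  finally have col0: "A' *\<^sub>v unit_vec n 0 = e \<cdot>\<^sub>v unit_vec n 0" .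
  have c0: "A' $$ (i, 0) = (if i = 0 then e else 0)" if "i < n" for i
    using arg_cong[OF col0, of "\<lambda>v. v $ i"] A' that n by simp
  have r0: "A' $$ (0, i) = (if i = 0 then e else 0)" if "i < n" for i
  proof -
    have "A' $$ (0, i) = transpose_mat A' $$ (i, 0)" using that A' n by simp
    then show ?thesis using c0[OF that] sym' by simp
  qed
  define A3 where "A3 = mat k k (\<lambda>(i, j). A' $$ (Suc i, Suc j))"
  have A3: "A3 \<in> carrier_mat k k" by (simp add: A3_def)
  let ?E = "mat 1 1 (\<lambda>_. e)"
  have blk: "A' = four_block_mat ?E (0\<^sub>m 1 k) (0\<^sub>m k 1) A3"
  proof (rule eq_matI)
    fix i j assume "i < dim_row (four_block_mat ?E (0\<^sub>m 1 k) (0\<^sub>m k 1) A3)"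
      "j < dim_col (four_block_mat ?E (0\<^sub>m 1 k) (0\<^sub>m k 1) A3)"
    then have "i < n" "j < n" by (auto simp: n A3_def)
    then show "A' $$ (i, j) = four_block_mat ?E (0\<^sub>m 1 k) (0\<^sub>m k 1) A3 $$ (i, j)"
      by (cases i; cases j) (auto simp: n c0 r0 A3_def)
  qed (use A' in \<open>auto simp: n A3_def\<close>)
  have "transpose_mat A3 = A3"
  proof (rule eq_matI)
    fix i j assume "i < dim_row A3" "j < dim_col A3"
    then have "i < k" "j < k" by (auto simp: A3_def)
    then show "transpose_mat A3 $$ (i, j) = A3 $$ (i, j)"
      using arg_cong[OF sym', of "\<lambda>M. M $$ (Suc i, Suc j)"] A' by (simp add: A3_def n)
  qed (auto simp: A3_def)
  \<comment> \<open>Similarity keeps the characteristic polynomial and the block form factors it, so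
    the linear factor of \<open>e\<close> cancels.\<close>
  moreover have "char_poly A3 = (\<Prod>e\<leftarrow>es. [:- e, 1:])"
  proof -
    have "similar_mat A' A"
      unfolding similar_mat_def using W A A'
      by (intro exI[of _ W] similar_mat_witI[of _ _ n]) (auto simp: A'_def)
    then have "char_poly A' = [:- e, 1:] * (\<Prod>e\<leftarrow>es. [:- e, 1:])"
      using Cons.prems(3) by (metis char_poly_similar list.simps(9) prod_list.Cons)
    moreover have "char_poly A' = char_poly ?E * char_poly A3"
      unfolding blk by (rule char_poly_four_block_zeros_col[of _ _ k]) (use A3 in auto)
    moreover have "char_poly ?E = [:- e, 1:]"
      by (simp add: char_poly_defs det_def sign_def)
    ultimately show ?thesis by (metis mult_cancel_left pCons_eq_0_iff zero_neq_one)
  qed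
  ultimately obtain P where P: "P \<in> carrier_mat k k" "transpose_mat P * P = 1\<^sub>m k"
    "transpose_mat P * A3 * P = mat k k (\<lambda>(i, j). if i = j then es ! i else 0)"
    using Cons.IH[OF A3] by blast
  define F where "F = four_block_mat (1\<^sub>m 1) (0\<^sub>m 1 k) (0\<^sub>m k 1) P"
  have F: "F \<in> carrier_mat n n" using four_block_carrier_mat[OF one_carrier_mat[of 1] P(1)] by (simp add: F_def n)
  have FT: "transpose_mat F = four_block_mat (1\<^sub>m 1) (0\<^sub>m 1 k) (0\<^sub>m k 1) (transpose_mat P)"
    unfolding F_def by (subst transpose_four_block_mat[of _ 1 1 _ k _ k]) (use P in auto)
  have FF: "transpose_mat F * F = 1\<^sub>m n"
    unfolding FT unfolding F_def n
    by (subst mult_four_block_mat[of _ 1 1 _ k _ k _ _ 1 _ k]) (use P in \<open>auto intro!: eq_matI\<close>)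
  have FAF: "transpose_mat F * A' * F = mat n n (\<lambda>(i, j). if i = j then (e # es) ! i else 0)"
  proof -
    have "transpose_mat F * A' = four_block_mat ?E (0\<^sub>m 1 k) (0\<^sub>m k 1) (transpose_mat P * A3)"
      unfolding FT blk
      by (subst mult_four_block_mat[of _ 1 1 _ k _ k _ _ 1 _ k]) (use P A3 in auto)
    also have "\<dots> * F = four_block_mat ?E (0\<^sub>m 1 k) (0\<^sub>m k 1) (transpose_mat P * A3 * P)"
      unfolding F_def
      by (subst mult_four_block_mat[of _ 1 1 _ k _ k _ _ 1 _ k]) (use P A3 in auto)
    also have "\<dots> = mat n n (\<lambda>(i, j). if i = j then (e # es) ! i else 0)"
      unfolding P(3) by (rule eq_matI) (auto simp: n nth_Cons')
    finally show ?thesis .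
  qed
  show ?case
  proof (intro bexI[of _ "W * F"] conjI)
    show "W * F \<in> carrier_mat n n" using W F by simp
    have T: "transpose_mat (W * F) = transpose_mat F * W"
      using W F by (simp add: transpose_mult[of _ n n _ n])
    have "transpose_mat F * W * (W * F) = transpose_mat F * (W * W) * F"
      using W(1) F by (simp add: assoc_mult_mat[of _ n n _ n _ n])
    then show "transpose_mat (W * F) * (W * F) = 1\<^sub>m n"
      using F FF by (simp add: T W(3))
    have "transpose_mat F * W * A * (W * F) = transpose_mat F * A' * F"
      using W(1) F A by (simp add: A'_def assoc_mult_mat[of _ n n _ n _ n])
    then show "transpose_mat (W * F) * A * (W * F) =
        mat n n (\<lambda>(i, j). if i = j then (e # es) ! i else 0)"
      by (simp add: T FAF)
  qed
qed

text \<open>Over the complex numbers the polynomial splits. For an eigenvector \<open>v\<close> with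
  eigenvalue \<open>z\<close>, the Hermitian form \<open>q\<close> equals \<open>z |v|^2\<close> and
  is its own conjugate by symmetry of \<open>A\<close>, so \<open>z\<close> is real.\<close>

lemma char_poly_symmetric_real_splits:
  fixes A :: "real mat"
  assumes A: "A \<in> carrier_mat n n" and sym: "transpose_mat A = A"
  shows "\<exists>es. char_poly A = (\<Prod>e\<leftarrow>es. [:- e, 1:]) \<and> length es = n"
proof -
  let ?C = "map_mat complex_of_real A"
  have C: "?C \<in> carrier_mat n n" using A by simp
  obtain zs where zs: "char_poly ?C = (\<Prod>z\<leftarrow>zs. [:- z, 1:])" "length zs = n"
    using char_poly_factorized[OF C] by blast
  have real: "z = of_real (Re z)" if "z \<in> set zs" for z
  proof -
    have "poly (char_poly ?C) z = 0"
      unfolding zs(1) poly_prod_list by (rule prod_list_zero_iff[THEN iffD2]) (use that in force)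
    then obtain v where v: "v \<in> carrier_vec n" "v \<noteq> 0\<^sub>v n" "?C *\<^sub>v v = z \<cdot>\<^sub>v v"
      using eigenvalue_root_char_poly[OF C] C unfolding eigenvalue_def eigenvector_def by auto
    have A_sym: "A $$ (i, j) = A $$ (j, i)" if "i < n" "j < n" for i j
      using arg_cong[OF sym, of "\<lambda>M. M $$ (i, j)"] that A by simp
    have row: "(\<Sum>j<n. of_real (A $$ (i, j)) * v $ j) = z * v $ i" if "i < n" for i
      using arg_cong[OF v(3), of "\<lambda>w. w $ i"] that A v(1)
      by (simp add: scalar_prod_def lessThan_atLeast0)
    define q where "q = (\<Sum>i<n. cnj (v $ i) * (\<Sum>j<n. of_real (A $$ (i, j)) * v $ j))"
    define N where "N = (\<Sum>i<n. (cmod (v $ i))\<^sup>2)"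
    have "q = (\<Sum>i<n. z * of_real ((cmod (v $ i))\<^sup>2))"
      unfolding q_def complex_norm_square
      by (intro sum.cong refl, subst row) (simp_all add: mult_ac)
    then have qz: "q = z * of_real N" by (simp add: N_def sum_distrib_left)
    have "cnj q = (\<Sum>i<n. \<Sum>j<n. v $ i * (of_real (A $$ (i, j)) * cnj (v $ j)))"
      by (simp add: q_def sum_distrib_left)
    also have "\<dots> = (\<Sum>j<n. \<Sum>i<n. v $ i * (of_real (A $$ (i, j)) * cnj (v $ j)))"
      by (rule sum.swap)
    also have "\<dots> = q"
      unfolding q_def sum_distrib_left by (intro sum.cong refl) (simp add: A_sym mult_ac)
    finally have "Im q = 0" by (simp add: complex_eq_iff)
    moreover have "N > 0"
    proof -
      obtain k where "k < n" "v $ k \<noteq> 0"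
        using v(1,2) by (metis carrier_vecD eq_vecI index_zero_vec(1) index_zero_vec(2))
      then show ?thesis unfolding N_def by (intro sum_pos2[of _ k]) auto
    qed
    ultimately show ?thesis by (simp add: qz complex_eq_iff)
  qed
  \<comment> \<open>The coefficientwise embedding is injective, so a factorization with real roots
    descends to the real polynomial.\<close>
  let ?h = "map_poly complex_of_real"
  interpret h: map_poly_inj_idom_hom complex_of_real ..
  have "?h (char_poly A) = char_poly ?C"
    by (rule of_real_hom.char_poly_hom[OF A, symmetric])
  also have "\<dots> = (\<Prod>z\<leftarrow>zs. [:- of_real (Re z), 1:])"
    unfolding zs(1) by (intro arg_cong[of _ _ prod_list] map_cong refl) (use real in force)
  also have "\<dots> = ?h (\<Prod>e\<leftarrow>map Re zs. [:- e, 1:])"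
    by (simp add: h.hom_prod_list o_def)
  finally have "char_poly A = (\<Prod>e\<leftarrow>map Re zs. [:- e, 1:])" by simp
  with zs(2) show ?thesis by (intro exI[of _ "map Re zs"]) simp
qed

text \<open>\<open>eigenvalues_desc\<close> collects only real roots; because the polynomial splits,
  none is missing and the list can be indexed below \<open>n\<close>.\<close>

lemma eigenvalues_desc_symmetric:
  fixes A :: "real mat"
  assumes A: "A \<in> carrier_mat n n" and sym: "transpose_mat A = A"
  shows "char_poly A = (\<Prod>e\<leftarrow>eigenvalues_desc A. [:- e, 1:])"
    and "length (eigenvalues_desc A) = n"
    and "sorted (rev (eigenvalues_desc A))"
proof -
  obtain es where es: "char_poly A = (\<Prod>e\<leftarrow>es. [:- e, 1:])" "length es = n"
    using char_poly_symmetric_real_splits[OF assms] by blast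
  have "proots (\<Prod>e\<leftarrow>es. [:- e, 1::real:]) = mset es"
  proof (induction es)
    case (Cons e es)
    have "monic (\<Prod>e\<leftarrow>es. [:- e, 1::real:])" by (rule monic_prod_list) auto
    then have "(\<Prod>e\<leftarrow>es. [:- e, 1::real:]) \<noteq> 0" by force
    then show ?case using Cons by (simp add: proots_mult del: mult_pCons_left)
  qed simp
  then have *: "mset (eigenvalues_desc A) = mset es"
    unfolding eigenvalues_desc_def es(1) by simp
  have "(\<Prod>e\<leftarrow>es. [:- e, 1:]) = prod_mset (image_mset (\<lambda>e. [:- e, 1:]) (mset es))" for es :: "real list"
    by (simp add: prod_mset_prod_list[symmetric])
  then show "char_poly A = (\<Prod>e\<leftarrow>eigenvalues_desc A. [:- e, 1:])"
    by (simp only: es(1) *)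
  show "length (eigenvalues_desc A) = n" using mset_eq_length[OF *] es(2) by simp
  show "sorted (rev (eigenvalues_desc A))" by (simp add: eigenvalues_desc_def)
qed

text \<open>The easy half of the Courant--Fischer principle for \<open>\<lambda>\<^sub>2\<close>.\<close>

lemma lambda_2_gt:
  fixes A :: "real mat"
  assumes A: "A \<in> carrier_mat n n" and sym: "transpose_mat A = A" and n: "n \<ge> 2"
    and x: "x \<in> carrier_vec n" and y: "y \<in> carrier_vec n"
    and gt: "\<And>a b z. (a, b) \<noteq> (0, 0) \<Longrightarrow> z = a \<cdot>\<^sub>v x + b \<cdot>\<^sub>v y \<Longrightarrow> z \<bullet> (A *\<^sub>v z) > \<mu> * (z \<bullet> z)"
  shows "lambda 2 A > \<mu>"
proof -
  define es where "es = eigenvalues_desc A"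
  note es = eigenvalues_desc_symmetric[OF A sym, folded es_def]
  obtain P where P: "P \<in> carrier_mat n n" "transpose_mat P * P = 1\<^sub>m n"
    and D: "transpose_mat P * A * P = mat n n (\<lambda>(i, j). if i = j then es ! i else 0)"
    using symmetric_mat_diagonalization[OF A sym es(1)] by blast
  have PP: "P * transpose_mat P = 1\<^sub>m n"
    using mat_mult_left_right_inverse[OF _ P(1) P(2)] P(1) by simp
  let ?T = "transpose_mat P"
  have T: "?T \<in> carrier_mat n n" using P by simp
  define p where "p w = (?T *\<^sub>v w) $ 0" for w
  \<comment> \<open>One linear condition on two coefficients has a nontrivial solution: some
    combination of \<open>x\<close> and \<open>y\<close> is orthogonal to the first column of
    \<open>P\<close>, a top eigenvector.\<close>
  obtain a b where ab: "(a, b) \<noteq> (0, 0)" "a * p x + b * p y = 0"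
  proof (cases "p x = 0 \<and> p y = 0")
    case True then show ?thesis using that[of 1 0] by simp
  next
    case False then show ?thesis using that[of "p y" "- p x"] by auto
  qed
  define z where "z = a \<cdot>\<^sub>v x + b \<cdot>\<^sub>v y"
  have z: "z \<in> carrier_vec n" using x y by (simp add: z_def)
  define c where "c = ?T *\<^sub>v z"
  have c: "c \<in> carrier_vec n" using T z by (simp add: c_def)
  have "c = a \<cdot>\<^sub>v (?T *\<^sub>v x) + b \<cdot>\<^sub>v (?T *\<^sub>v y)"
    unfolding c_def z_def using x y T
    by (simp add: mult_add_distrib_mat_vec[of _ n n] mult_mat_vec[of _ n n])
  then have c0: "c $ 0 = 0" using n x y T ab(2) by (simp add: p_def)
  have zc: "z = P *\<^sub>v c"
    using assoc_mult_mat_vec[OF P(1) T z] z by (simp add: c_def PP)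
  have "z \<bullet> z = c \<bullet> c"
  proof -
    have "z \<bullet> z = (P *\<^sub>v c) \<bullet> z" by (simp add: zc)
    also have "\<dots> = c \<bullet> (?T *\<^sub>v z)"
      using transpose_vec_mult_scalar[OF P(1) c z] P(1) c z
      by (metis comm_scalar_prod T mult_mat_vec_carrier)
    finally show ?thesis by (simp add: c_def)
  qed
  then have zz: "z \<bullet> z = (\<Sum>i<n. (c $ i)\<^sup>2)"
    using c by (simp add: scalar_prod_def power2_eq_square lessThan_atLeast0)
  have "z \<bullet> (A *\<^sub>v z) = (P *\<^sub>v c) \<bullet> (A *\<^sub>v z)" by (simp add: zc)
  also have "\<dots> = c \<bullet> (?T *\<^sub>v (A *\<^sub>v z))"
    using transpose_vec_mult_scalar[OF P(1) c, of "A *\<^sub>v z"] P(1) c z A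
    by (metis comm_scalar_prod T mult_mat_vec_carrier)
  also have "?T *\<^sub>v (A *\<^sub>v z) = (?T * A * P) *\<^sub>v c"
    using T A P(1) c unfolding zc by (simp add: assoc_mult_mat_vec[of _ n n _ n])
  also have "c \<bullet> \<dots> = (\<Sum>i<n. es ! i * (c $ i)\<^sup>2)"
  proof -
    have "((?T * A * P) *\<^sub>v c) $ i = es ! i * c $ i" if "i < n" for i
    proof -
      have "((?T * A * P) *\<^sub>v c) $ i = (\<Sum>j<n. (if i = j then es ! i else 0) * c $ j)"
        unfolding D using that c by (simp add: scalar_prod_def lessThan_atLeast0)
      then show ?thesis using that by (simp add: mult_delta_left)
    qed
    then show ?thesis
      using c unfolding D
      by (auto simp: scalar_prod_def lessThan_atLeast0 power2_eq_square intro!: sum.cong)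
  qed
  \<comment> \<open>The top eigenvalue drops out because \<open>c $ 0 = 0\<close>; all others are at
    most \<open>es ! 1\<close>, the second largest.\<close>
  also have "\<dots> \<le> (\<Sum>i<n. es ! 1 * (c $ i)\<^sup>2)"
  proof (rule sum_mono)
    fix i assume i: "i \<in> {..<n}"
    show "es ! i * (c $ i)\<^sup>2 \<le> es ! 1 * (c $ i)\<^sup>2"
    proof (cases "i = 0")
      case False
      have "es ! i \<le> es ! 1"
        using sorted_rev_nth_mono[OF es(3), of 1 i] False i es(2) by simp
      then show ?thesis by (rule mult_right_mono) simp
    qed (simp add: c0)
  qed
  also have "\<dots> = es ! 1 * (z \<bullet> z)" by (simp add: zz sum_distrib_left)
  finally have "\<mu> * (z \<bullet> z) < es ! 1 * (z \<bullet> z)"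
    using gt[OF ab(1) z_def] by linarith
  moreover have "z \<bullet> z \<ge> 0" unfolding zz by (intro sum_nonneg) auto
  ultimately have "\<mu> < es ! 1" by (metis mult_right_mono not_le)
  then show ?thesis by (simp add: lambda_def es_def)
qed

subsection \<open>Exponentially decaying test functions\<close>

text \<open>\<open>H\<close> indexes the half-edges at each vertex, and \<open>nb h x\<close> is the other end of the half-edge \<open>h\<close> at
  \<open>x\<close>.\<close>

locale rooted_multigraph =
  fixes V :: "'v set" and H :: "'h set" and nb :: "'h \<Rightarrow> 'v \<Rightarrow> 'v"
    and S :: "'v set" and H0 :: "'h set" and s :: nat
  assumes finite_V: "finite V" and finite_H: "finite H"
    and nb_closed: "\<And>h x. h \<in> H \<Longrightarrow> x \<in> V \<Longrightarrow> nb h x \<in> V"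
    and nb_rev: "\<And>h x. h \<in> H \<Longrightarrow> x \<in> V \<Longrightarrow> \<exists>h'\<in>H. nb h' (nb h x) = x"
    and S: "S \<subseteq> V" "S \<noteq> {}"
    and H0: "H0 \<subseteq> H" "card H0 = s + 1" "\<And>h x. h \<in> H0 \<Longrightarrow> x \<in> S \<Longrightarrow> nb h x \<in> S"
    and s_pos: "s > 0"
begin

primrec nbhd :: "nat \<Rightarrow> 'v set" where
  "nbhd 0 = S"
| "nbhd (Suc i) = nbhd i \<union> (\<Union>h\<in>H. nb h ` nbhd i)"

definition shell :: "nat \<Rightarrow> 'v set" where
  "shell i = {x \<in> nbhd i. \<forall>j<i. x \<notin> nbhd j}"

definition depth :: "'v \<Rightarrow> nat" where
  "depth x = (LEAST i. x \<in> nbhd i)"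

text \<open>\<open>depth\<close> is meaningful only for vertices reachable from \<open>S\<close>,
  and the truncation ensures that it is consulted only there.\<close>

definition decay :: "nat \<Rightarrow> 'v \<Rightarrow> real" where
  "decay R x = (if x \<in> nbhd R then (1 / real s) ^ depth x else 0)"

lemma nbhd_subset: "nbhd i \<subseteq> V"
  using S nb_closed by (induction i) auto

lemma finite_nbhd: "finite (nbhd i)"
  using finite_subset[OF nbhd_subset finite_V] .

lemma nbhd_mono: "i \<le> j \<Longrightarrow> nbhd i \<subseteq> nbhd j"
  by (rule lift_Suc_mono_le[of nbhd]) auto

lemma shell_subset: "shell i \<subseteq> nbhd i"
  by (auto simp: shell_def)

lemma card_UN_nb_le: "finite T \<Longrightarrow> card (\<Union>h\<in>H. nb h ` T) \<le> card H * card T"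
  by (rule order.trans[OF card_UN_le[OF finite_H]])
    (use card_image_le[of T] in \<open>auto intro!: sum_bounded_above[THEN order.trans]\<close>)

lemma card_nbhd_le: "card (nbhd i) \<le> (card H + 1) ^ i * card S"
proof (induction i)
  case (Suc i)
  have "card (nbhd (Suc i)) \<le> card (nbhd i) + card H * card (nbhd i)"
    using card_Un_le[of "nbhd i" "\<Union>h\<in>H. nb h ` nbhd i"] card_UN_nb_le[OF finite_nbhd[of i]] by simp
  also have "\<dots> = (card H + 1) * card (nbhd i)" by simp
  also have "\<dots> \<le> (card H + 1) * ((card H + 1) ^ i * card S)"
    by (rule mult_le_mono2[OF Suc])
  finally show ?case by (simp only: power_Suc mult.assoc)
qed simp

text \<open>A vertex at distance \<open>i + 1\<close> has a neighbour at distance exactly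
  \<open>i\<close>. The growth factor \<open>card H\<close> is what the decay of the squares,
  \<open>1 / s^2\<close> per level, has to beat.\<close>

lemma card_shell_le: "card (shell i) \<le> card H ^ i * card S"
proof (induction i)
  case 0
  then show ?case by (simp add: shell_def)
next
  case (Suc i)
  have "shell (Suc i) \<subseteq> (\<Union>h\<in>H. nb h ` shell i)"
  proof
    fix x assume x: "x \<in> shell (Suc i)"
    then obtain h y where h: "h \<in> H" "y \<in> nbhd i" "x = nb h y"
      by (auto simp: shell_def)
    \<comment> \<open>If \<open>y\<close> were closer to \<open>S\<close>, then \<open>x\<close>
      would already lie in \<open>nbhd (Suc j)\<close>.\<close>
    have "y \<notin> nbhd j" if "j < i" for j
      using x h that by (force simp: shell_def dest: spec[of _ "Suc j"])
    then show "x \<in> (\<Union>h\<in>H. nb h ` shell i)" using h by (auto simp: shell_def)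
  qed
  then have "card (shell (Suc i)) \<le> card H * card (shell i)"
    using card_UN_nb_le[of "shell i"] finite_subset[OF shell_subset finite_nbhd] finite_H
    by (meson card_mono finite_UN finite_imageI order.trans)
  also have "\<dots> \<le> card H * (card H ^ i * card S)" by (rule mult_le_mono2[OF Suc])
  finally show ?case by (simp add: mult.assoc)
qed

lemma depth_le: "x \<in> nbhd i \<Longrightarrow> depth x \<le> i"
  unfolding depth_def by (rule Least_le)

lemma in_shell_depth: "x \<in> nbhd i \<Longrightarrow> x \<in> shell (depth x)"
  unfolding shell_def depth_def using LeastI[of "\<lambda>i. x \<in> nbhd i"] not_less_Least by auto

lemma shell_depth: "x \<in> shell i \<Longrightarrow> depth x = i"
  unfolding shell_def depth_def by (intro Least_equality) (auto simp: not_le[symmetric])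

lemma decay_nonneg: "decay R x \<ge> 0"
  by (simp add: decay_def)

lemma decay_le_1: "decay R x \<le> 1"
  using s_pos by (auto simp: decay_def intro!: power_le_one)

lemma decay_ge: "x \<in> nbhd i \<Longrightarrow> i \<le> R \<Longrightarrow> decay R x \<ge> (1 / real s) ^ i"
  using nbhd_mono[of i R] depth_le[of x i] s_pos
  by (auto simp: decay_def intro!: power_decreasing)

text \<open>Up to the truncation, \<open>decay R\<close> is a subsolution for the value \<open>s + (card H - 1) / s\<close>: the edge
  towards \<open>S\<close> gains a factor \<open>s\<close> and all other edges lose at most that factor.\<close>

lemma decay_neighbours:
  assumes x: "x \<in> V" and R: "R > 0"
  shows "(\<Sum>h\<in>H. decay R (nb h x)) \<ge> (s + (real (card H) - 1) / s) * decay R x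
    - (if x \<in> shell R then (real (card H) - 1) / s * decay R x else 0)"
proof (cases "x \<in> nbhd R")
  case False
  then show ?thesis using shell_subset[of R] sum_nonneg[of H "\<lambda>h. decay R (nb h x)"]
    by (auto simp: decay_def)
next
  case True
  define i where "i = depth x"
  have xi: "x \<in> shell i" using in_shell_depth[OF True] by (simp add: i_def)
  have iR: "i \<le> R" using depth_le[OF True] by (simp add: i_def)
  let ?t = "1 / real s"
  have fx: "decay R x = ?t ^ i" using True by (simp add: decay_def i_def)
  have up: "decay R (nb h x) \<ge> ?t ^ Suc i" if "h \<in> H" "i < R" for h
    using xi that by (intro decay_ge) (auto simp: shell_def)
  show ?thesis
  proof (cases i)
    case 0
    have xS: "x \<in> S" using xi 0 by (simp add: shell_def)
    have notR: "x \<notin> shell R" using shell_depth R 0 by (force simp: i_def)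
    \<comment> \<open>On \<open>S\<close> there is no inward edge. Instead the \<open>s + 1\<close>
      half-edges of \<open>H0\<close> stay in \<open>S\<close> and contribute 1 each, and
      \<open>(s + 1) + (d - s - 1) / s\<close> is again \<open>s + (d - 1) / s\<close> for
      \<open>d = card H\<close>.\<close>
    have "(s + 1) + (real (card H) - (s + 1)) * ?t = (\<Sum>h\<in>H0. 1) + (\<Sum>h\<in>H - H0. ?t)"
      using H0 card_Diff_subset[OF finite_subset[OF H0(1) finite_H] H0(1)]
        card_mono[OF finite_H H0(1)] by (simp add: of_nat_diff)
    also have "\<dots> \<le> (\<Sum>h\<in>H0. decay R (nb h x)) + (\<Sum>h\<in>H - H0. decay R (nb h x))"
    proof (intro add_mono sum_mono)
      show "1 \<le> decay R (nb h x)" if "h \<in> H0" for h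
        using decay_ge[of "nb h x" 0 R] H0(3)[OF that xS] by simp
      show "?t \<le> decay R (nb h x)" if "h \<in> H - H0" for h
        using up[of h] that 0 R by simp
    qed
    also have "\<dots> = (\<Sum>h\<in>H. decay R (nb h x))"
      using sum.subset_diff[OF H0(1) finite_H] by (metis add.commute)
    finally show ?thesis using notR s_pos fx 0 by (simp add: field_simps)
  next
    case (Suc k)
    obtain h y where h: "h \<in> H" "y \<in> nbhd k" "x = nb h y"
      using xi Suc by (auto simp: shell_def)
    \<comment> \<open>Reversing the half-edge by which \<open>x\<close> was reached gives a
      neighbour one level closer to \<open>S\<close>.\<close>
    obtain h0 where h0: "h0 \<in> H" "nb h0 x = y"
      using nb_rev[OF h(1), of y] h nbhd_subset by blast
    have down: "decay R (nb h0 x) \<ge> ?t ^ k"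
      using h h0 iR Suc by (intro decay_ge) auto
    have split: "(\<Sum>h\<in>H. decay R (nb h x)) =
        decay R (nb h0 x) + (\<Sum>h\<in>H - {h0}. decay R (nb h x))"
      by (rule sum.remove[OF finite_H h0(1)])
    have tk: "?t ^ k = s * ?t ^ i" using s_pos by (simp add: Suc)
    have c1: "real (card (H - {h0})) = real (card H) - 1"
      using card_Diff_singleton[OF h0(1)] finite_H h0(1) card_gt_0_iff[of H] by (auto simp: of_nat_diff)
    show ?thesis
    proof (cases "i = R")
      case True
      \<comment> \<open>On the outermost sphere the outward neighbours may be cut off to 0, so only
        the inward edge is counted; this is the loss subtracted in the statement.\<close>
      have "(\<Sum>h\<in>H. decay R (nb h x)) \<ge> s * ?t ^ i"
        using split down tk sum_nonneg[of "H - {h0}" "\<lambda>h. decay R (nb h x)"] decay_nonneg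
        by fastforce
      then show ?thesis using xi True fx by (simp add: algebra_simps)
    next
      case False
      have notR: "x \<notin> shell R" using shell_depth False by (force simp: i_def)
      have "(real (card H) - 1) * ?t ^ Suc i = (\<Sum>h\<in>H - {h0}. ?t ^ Suc i)" by (simp add: c1)
      also have "\<dots> \<le> (\<Sum>h\<in>H - {h0}. decay R (nb h x))"
        by (intro sum_mono up) (use False iR in auto)
      finally show ?thesis
        using split down notR fx unfolding tk by (simp add: algebra_simps)
    qed
  qed
qed

text \<open>The bound does not depend on the size of \<open>V\<close>, which makes the test function
  nearly orthogonal to the constants in a large graph.\<close>

lemma sum_decay_le: "(\<Sum>x\<in>V. decay R x) \<le> (real (card H) + 1) ^ R * card S"
proof -
  have "(\<Sum>x\<in>V. decay R x) = (\<Sum>x\<in>nbhd R. decay R x)"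
    by (rule sum.mono_neutral_right[OF finite_V nbhd_subset]) (simp add: decay_def)
  also have "\<dots> \<le> card (nbhd R)"
    using sum_bounded_above[of "nbhd R" "decay R" 1] decay_le_1 by simp
  also have "\<dots> \<le> real ((card H + 1) ^ R * card S)"
    by (subst of_nat_le_iff) (rule card_nbhd_le)
  finally show ?thesis by (simp add: add.commute)
qed

lemma sum_decay_sq_ge: "(\<Sum>x\<in>V. (decay R x)\<^sup>2) \<ge> card S"
proof -
  have "real (card S) = (\<Sum>x\<in>S. 1)" by simp
  also have "\<dots> \<le> (\<Sum>x\<in>S. (decay R x)\<^sup>2)"
    using decay_ge[of _ 0 R] by (intro sum_mono one_le_power) auto
  also have "\<dots> \<le> (\<Sum>x\<in>V. (decay R x)\<^sup>2)"
    by (rule sum_mono2[OF finite_V S(1)]) simp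
  finally show ?thesis .
qed

text \<open>Summing \<open>decay_neighbours\<close> against \<open>decay R\<close> loses only on the
  sphere of radius \<open>R\<close>: at most \<open>card H ^ R * card S\<close> vertices, each with
  square \<open>s^(-2R)\<close>. Since \<open>card S\<close> is at most the squared norm, the loss
  is a geometrically small fraction of it.\<close>

lemma decay_quadratic_form:
  assumes R: "R > 0" and H: "H \<noteq> {}"
  shows "(\<Sum>x\<in>V. decay R x * (\<Sum>h\<in>H. decay R (nb h x))) \<ge>
    (s + (real (card H) - 1) / s * (1 - (real (card H) / (real s)\<^sup>2) ^ R)) * (\<Sum>x\<in>V. (decay R x)\<^sup>2)"
proof -
  let ?d = "real (card H)" and ?Q = "\<Sum>x\<in>V. (decay R x)\<^sup>2"
  define c where "c = (?d - 1) / s"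
  have "card H > 0" using H finite_H by (simp add: card_gt_0_iff)
  then have c: "c \<ge> 0" using s_pos by (simp add: c_def)
  have "(\<Sum>x\<in>V. if x \<in> shell R then c * (decay R x)\<^sup>2 else 0) = (\<Sum>x\<in>shell R. c * (decay R x)\<^sup>2)"
    using shell_subset nbhd_subset[of R] finite_V
    by (subst sum.inter_restrict[symmetric]) (auto intro!: sum.cong)
  also have "\<dots> = (\<Sum>x\<in>shell R. c * (1 / (real s)\<^sup>2) ^ R)"
    using shell_subset[of R]
    by (intro sum.cong) (auto simp: decay_def shell_depth power_divide power_mult[symmetric] mult.commute)
  also have "\<dots> \<le> (?d ^ R * card S) * (c * (1 / (real s)\<^sup>2) ^ R)"
  proof -
    have "real (card (shell R)) \<le> ?d ^ R * card S"
      using card_shell_le[of R] by (metis of_nat_le_iff of_nat_mult of_nat_power)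
    then show ?thesis using c by (simp add: mult_right_mono)
  qed
  also have "\<dots> = c * (?d / (real s)\<^sup>2) ^ R * card S" by (simp add: power_divide)
  also have "\<dots> \<le> c * (?d / (real s)\<^sup>2) ^ R * ?Q"
    using c sum_decay_sq_ge by (intro mult_left_mono) auto
  finally have err: "(\<Sum>x\<in>V. if x \<in> shell R then c * (decay R x)\<^sup>2 else 0) \<le>
    c * (?d / (real s)\<^sup>2) ^ R * ?Q" .
  have "(s + c) * ?Q - (\<Sum>x\<in>V. if x \<in> shell R then c * (decay R x)\<^sup>2 else 0) =
      (\<Sum>x\<in>V. decay R x * ((s + c) * decay R x - (if x \<in> shell R then c * decay R x else 0)))"
    unfolding sum_distrib_left sum_subtractf[symmetric]
    by (intro sum.cong) (auto simp: power2_eq_square algebra_simps)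
  also have "\<dots> \<le> (\<Sum>x\<in>V. decay R x * (\<Sum>h\<in>H. decay R (nb h x)))"
    using decay_neighbours[OF _ R, folded c_def]
    by (intro sum_mono mult_left_mono decay_nonneg)
  finally show ?thesis using err unfolding c_def by (simp add: algebra_simps)
qed

end

subsection \<open>The graph of a family of permutations\<close>

text \<open>Labels are a permutation index and a direction. This keeps multiplicities: a fixed point
  gives two half-edges, matching its contribution 2 to the diagonal of the adjacency matrix.\<close>

definition half_edges :: "nat \<Rightarrow> (nat \<times> bool) set" where
  "half_edges k = {1..k} \<times> UNIV"

fun neighbour :: "(nat \<Rightarrow> nat \<Rightarrow> nat) \<Rightarrow> nat \<times> bool \<Rightarrow> nat \<Rightarrow> nat" where
  "neighbour \<pi> (j, b) = (if b then \<pi> j else Hilbert_Choice.inv (\<pi> j))"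

lemma finite_half_edges [simp]: "finite (half_edges k)"
  by (simp add: half_edges_def)

lemma card_half_edges [simp]: "card (half_edges k) = 2 * k"
  by (simp add: half_edges_def card_cartesian_product)

lemma sum_half_edges:
  "(\<Sum>h\<in>half_edges k. g h) = (\<Sum>j=1..k. g (j, True) + g (j, False))"
  by (simp add: half_edges_def sum.cartesian_product' UNIV_bool add.commute)

lemma neighbour_permutes:
  assumes "\<And>j. j \<in> {1..k} \<Longrightarrow> \<pi> j permutes {0..<n}" "h \<in> half_edges k"
  shows "neighbour \<pi> h permutes {0..<n}"
  using assms by (cases h) (auto simp: half_edges_def permutes_inv)

lemma adjacency_of_perms_carrier: "adjacency_of_perms n d \<pi> \<in> carrier_mat n n"
  by (simp add: adjacency_of_perms_def)

lemma adjacency_of_perms_symmetric: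
  assumes "\<And>j. j \<in> {1..d div 2} \<Longrightarrow> \<pi> j permutes {0..<n}"
  shows "transpose_mat (adjacency_of_perms n d \<pi>) = adjacency_of_perms n d \<pi>"
proof (rule eq_matI)
  fix u v
  assume "u < dim_row (adjacency_of_perms n d \<pi>)" "v < dim_col (adjacency_of_perms n d \<pi>)"
  then have "u < n" "v < n" by (simp_all add: adjacency_of_perms_def)
  then show "transpose_mat (adjacency_of_perms n d \<pi>) $$ (u, v) = adjacency_of_perms n d \<pi> $$ (u, v)"
    using permutes_inv_eq[OF assms]
    by (auto simp: adjacency_of_perms_def perm_matrix_def intro!: sum.cong)
qed (simp_all add: adjacency_of_perms_def)

lemma adjacency_of_perms_mult_vec:
  assumes perm: "\<And>j. j \<in> {1..d div 2} \<Longrightarrow> \<pi> j permutes {0..<n}" and u: "u < n"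
  shows "(adjacency_of_perms n d \<pi> *\<^sub>v vec n g) $ u = (\<Sum>h\<in>half_edges (d div 2). g (neighbour \<pi> h u))"
proof -
  have delta: "(\<Sum>v\<in>{0..<n}. (if w = v then 1 else 0) * g v) = g w" if "w < n" for w
    using that by (simp add: mult_delta_left)
  have "(adjacency_of_perms n d \<pi> *\<^sub>v vec n g) $ u =
      (\<Sum>v\<in>{0..<n}. (\<Sum>j=1..d div 2. ((if \<pi> j u = v then 1 else 0) * g v
         + (if Hilbert_Choice.inv (\<pi> j) u = v then 1 else 0) * g v)))"
    using u by (simp add: adjacency_of_perms_def perm_matrix_def scalar_prod_def
        sum_distrib_right distrib_right)
  also have "\<dots> = (\<Sum>j=1..d div 2. (\<Sum>v\<in>{0..<n}. (if \<pi> j u = v then 1 else 0) * g v)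
         + (\<Sum>v\<in>{0..<n}. (if Hilbert_Choice.inv (\<pi> j) u = v then 1 else 0) * g v))"
    by (subst sum.swap) (simp add: sum.distrib)
  also have "\<dots> = (\<Sum>j=1..d div 2. g (\<pi> j u) + g (Hilbert_Choice.inv (\<pi> j) u))"
  proof (intro sum.cong refl arg_cong2[of _ _ _ _ "(+)"] delta)
    fix j assume "j \<in> {1..d div 2}"
    then show "\<pi> j u < n" "Hilbert_Choice.inv (\<pi> j) u < n"
      using permutes_in_image[OF perm[of j], of u] permutes_in_image[OF permutes_inv[OF perm[of j]], of u] u
      by auto
  qed
  finally show ?thesis by (simp add: sum_half_edges)
qed

text \<open>The two-dimensional test space is spanned by \<open>f\<close> and the constant function.\<close>

lemma lambda_2_adjacency_gt:
  assumes perm: "\<And>j. j \<in> {1..d div 2} \<Longrightarrow> \<pi> j permutes {0..<n}" and n: "n \<ge> 2" and d: "even d"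
    and \<mu>: "\<mu> < real d"
    and form: "(\<Sum>u<n. f u * (\<Sum>h\<in>half_edges (d div 2). f (neighbour \<pi> h u))) \<ge> (\<mu> + \<delta>) * (\<Sum>u<n. (f u)\<^sup>2)"
    and norm: "(\<Sum>u<n. (f u)\<^sup>2) \<ge> 1" and \<delta>: "\<delta> > 0"
    and mass: "(real d - \<mu>) * (\<Sum>u<n. f u)\<^sup>2 < \<delta> * real n"
  shows "lambda 2 (adjacency_of_perms n d \<pi>) > \<mu>"
proof (rule lambda_2_gt[OF adjacency_of_perms_carrier adjacency_of_perms_symmetric[OF perm] n])
  let ?A = "adjacency_of_perms n d \<pi>" and ?H = "half_edges (d div 2)"
  let ?F = "\<Sum>u<n. f u" and ?Q = "\<Sum>u<n. (f u)\<^sup>2"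
  let ?q = "\<Sum>u<n. f u * (\<Sum>h\<in>?H. f (neighbour \<pi> h u))"
  show "vec n f \<in> carrier_vec n" "vec n (\<lambda>_. 1) \<in> carrier_vec n" by simp_all
  fix a b :: real and z assume ab: "(a, b) \<noteq> (0, 0)" and z: "z = a \<cdot>\<^sub>v vec n f + b \<cdot>\<^sub>v vec n (\<lambda>_. 1)"
  define g where "g u = a * f u + b" for u
  have zg: "z = vec n g" by (rule eq_vecI) (auto simp: z g_def)
  have cH: "real (card ?H) = real d" using d by simp
  \<comment> \<open>Each half-edge label acts as a permutation of the vertices, so summing over
    neighbours only reorders the sum; equivalently, the constants are eigenvectors for
    \<open>d\<close>.\<close>
  have shift: "(\<Sum>u<n. \<Sum>h\<in>?H. f (neighbour \<pi> h u)) = d * ?F"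
  proof -
    have sum_nb: "(\<Sum>u<n. f (neighbour \<pi> h u)) = ?F" if "h \<in> ?H" for h
    proof -
      have "neighbour \<pi> h permutes {0..<n}" by (rule neighbour_permutes[OF _ that]) (rule perm)
      then show ?thesis using sum.permute[of _ _ f] by (metis comp_apply lessThan_atLeast0 sum.cong)
    qed
    have "(\<Sum>u<n. \<Sum>h\<in>?H. f (neighbour \<pi> h u)) = (\<Sum>h\<in>?H. \<Sum>u<n. f (neighbour \<pi> h u))"
      by (rule sum.swap)
    also have "\<dots> = (\<Sum>h\<in>?H. ?F)"
      by (intro sum.cong refl sum_nb)
    finally show ?thesis using cH by simp
  qed
  have Ag: "(?A *\<^sub>v vec n g) $ u = (\<Sum>h\<in>?H. g (neighbour \<pi> h u))" if "u < n" for u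
    by (rule adjacency_of_perms_mult_vec[OF _ that]) (rule perm)
  have "z \<bullet> (?A *\<^sub>v z) = (\<Sum>u<n. vec n g $ u * (?A *\<^sub>v vec n g) $ u)"
    using adjacency_of_perms_carrier[of n d \<pi>] unfolding zg scalar_prod_def
    by (simp add: lessThan_atLeast0 del: index_mult_mat_vec)
  also have "\<dots> = (\<Sum>u<n. g u * (\<Sum>h\<in>?H. g (neighbour \<pi> h u)))"
    by (intro sum.cong refl) (simp add: Ag del: index_mult_mat_vec)
  also have "\<dots> = (\<Sum>u<n. a\<^sup>2 * (f u * (\<Sum>h\<in>?H. f (neighbour \<pi> h u)))
      + a * b * (\<Sum>h\<in>?H. f (neighbour \<pi> h u)) + a * b * d * f u + b\<^sup>2 * d)"
    using cH by (intro sum.cong refl)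
      (simp add: g_def sum.distrib sum_distrib_left[symmetric] algebra_simps power2_eq_square)
  also have "\<dots> = a\<^sup>2 * ?q + 2 * a * b * d * ?F + b\<^sup>2 * d * n"
    by (simp add: sum.distrib sum_distrib_left[symmetric] shift)
  finally have form_z: "z \<bullet> (?A *\<^sub>v z) = a\<^sup>2 * ?q + 2 * a * b * d * ?F + b\<^sup>2 * d * n" .
  have "z \<bullet> z = (\<Sum>u<n. (g u)\<^sup>2)"
    by (simp add: zg scalar_prod_def lessThan_atLeast0 power2_eq_square)
  also have "\<dots> = (\<Sum>u<n. a\<^sup>2 * (f u)\<^sup>2 + 2 * a * b * f u + b\<^sup>2)"
    by (intro sum.cong refl) (simp add: g_def power2_eq_square algebra_simps)
  also have "\<dots> = a\<^sup>2 * ?Q + 2 * a * b * ?F + b\<^sup>2 * n"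
    by (simp add: sum.distrib sum_distrib_left[symmetric])
  finally have norm_z: "z \<bullet> z = a\<^sup>2 * ?Q + 2 * a * b * ?F + b\<^sup>2 * n" .
  define D where "D = real d - \<mu>"
  have D: "D > 0" using \<mu> by (simp add: D_def)
  have "?q - \<mu> * ?Q \<ge> \<delta>"
    using form[unfolded distrib_right] mult_left_mono[OF norm less_imp_le[OF \<delta>]] by linarith
  then have "a\<^sup>2 * \<delta> \<le> a\<^sup>2 * (?q - \<mu> * ?Q)" by (intro mult_left_mono) auto
  moreover have "a\<^sup>2 * \<delta> + 2 * a * b * D * ?F + b\<^sup>2 * D * n > 0"
  proof (cases "a = 0")
    case True
    then show ?thesis using ab D n by simp
  next
    case False
    \<comment> \<open>Completing the square in \<open>b\<close>: the form is positive definite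
      exactly because of the bound \<open>mass\<close>.\<close>
    have "a\<^sup>2 * \<delta> + 2 * a * b * D * ?F + b\<^sup>2 * D * n =
        a\<^sup>2 * (\<delta> - D * ?F\<^sup>2 / n) + D * n * (b + a * ?F / n)\<^sup>2"
      using n by (simp add: field_simps power2_eq_square)
    moreover have "\<delta> - D * ?F\<^sup>2 / n > 0"
      using mass n by (simp add: D_def field_simps)
    ultimately show ?thesis using False D by (simp add: add_pos_nonneg)
  qed
  moreover have "z \<bullet> (?A *\<^sub>v z) - \<mu> * (z \<bullet> z) =
      a\<^sup>2 * (?q - \<mu> * ?Q) + 2 * a * b * D * ?F + b\<^sup>2 * D * n"
    unfolding form_z norm_z D_def by (simp add: algebra_simps)
  ultimately show "\<mu> * (z \<bullet> z) < z \<bullet> (?A *\<^sub>v z)" by linarith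
qed

section \<open>From vertices kept together by \<open>m\<close> permutations to a large second
  eigenvalue\<close>

lemma two_sqrt_less_add_divide:
  fixes s c :: real
  assumes "s > 0" "c \<ge> 0" "s \<noteq> sqrt c"
  shows "2 * sqrt c < s + c / s"
proof -
  \<comment> \<open>Strict AM-GM for \<open>s\<close> and \<open>c / s\<close>.\<close>
  have "0 < (s - sqrt c)\<^sup>2" using assms by simp
  then have "2 * sqrt c * s < s\<^sup>2 + c" using assms(2)
    by (simp add: power2_diff algebra_simps)
  then show ?thesis using assms(1) by (simp add: field_simps power2_eq_square)
qed

text \<open>\<open>u\<close> and \<open>v\<close> may coincide; then the first \<open>m\<close> permutations all fix \<open>u\<close>.\<close>

proposition lambda_2_gt_if_tangle:
  fixes m d :: nat
  assumes m: "m \<ge> 1" and d: "d \<ge> 4" "even d"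
    and gt: "2 * real m - 1 > sqrt (real d - 1)" and md: "m \<le> d div 2"
  obtains N where "\<And>n \<pi> u v. n \<ge> N \<Longrightarrow> (\<And>j. j \<in> {1..d div 2} \<Longrightarrow> \<pi> j permutes {0..<n}) \<Longrightarrow>
    u < n \<Longrightarrow> v < n \<Longrightarrow> (\<And>j. j \<in> {1..m} \<Longrightarrow> \<pi> j u = v \<and> \<pi> j v = u) \<Longrightarrow>
    lambda 2 (adjacency_of_perms n d \<pi>) > 2 * sqrt (real d - 1)"
proof -
  \<comment> \<open>The first \<open>m\<close> permutations give \<open>2 * m = s + 1\<close>
    half-edges that stay inside \<open>{u, v}\<close>.\<close>
  define s where "s = 2 * m - 1"
  have s: "s > 0" "odd s" "real s = 2 * real m - 1" using m by (auto simp: s_def of_nat_diff)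
  define \<mu> where "\<mu> = 2 * sqrt (real d - 1)"
  define c where "c = (real d - 1) / s"
  have "real d - 1 < (real s)\<^sup>2"
    using gt s(3) d by (metis real_less_lsqrt not_less real_sqrt_le_mono real_sqrt_unique sqrt_le_D of_nat_0_le_iff less_eq_real_def)
  then have "real d < real (s\<^sup>2 + 1)" by simp
  then have "d \<le> s\<^sup>2" by (simp only: of_nat_less_iff)
  moreover have "d \<noteq> s\<^sup>2" using s(2) d(2) by auto
  \<comment> \<open>Parity improves \<open>s\<^sup>2 > d - 1\<close> to \<open>s\<^sup>2 > d\<close>, so that even the crude bound \<open>d ^ i\<close> on the size of
    the spheres is beaten by the decay.\<close>
  ultimately have "d < s\<^sup>2" by simp
  then have "real d < (real s)\<^sup>2" by (metis of_nat_less_iff of_nat_power)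
  then have ratio: "0 \<le> real d / (real s)\<^sup>2" "real d / (real s)\<^sup>2 < 1"
    using s(1) by simp_all
  have \<mu>d: "\<mu> < real d"
  proof -
    have "0 < (real d - 2)\<^sup>2" using d by simp
    then have "4 * (real d - 1) < (real d)\<^sup>2" by (simp add: power2_diff algebra_simps)
    then have "sqrt (4 * (real d - 1)) < real d" using d by (intro real_less_lsqrt) auto
    then show ?thesis unfolding \<mu>_def real_sqrt_mult by simp
  qed
  \<comment> \<open>Half of the gap above \<mu>; the other half absorbs the truncation loss.\<close>
  define \<delta> where "\<delta> = (s + c - \<mu>) / 2"
  have \<delta>: "\<delta> > 0"
    using two_sqrt_less_add_divide[of "real s" "real d - 1"] s gt d by (simp add: \<delta>_def \<mu>_def c_def)
  have "(\<lambda>R. c * (real d / (real s)\<^sup>2) ^ R) \<longlonglongrightarrow> c * 0"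
    using ratio by (intro tendsto_mult LIMSEQ_power_zero tendsto_const) auto
  then have "\<forall>\<^sub>F R in sequentially. c * (real d / (real s)\<^sup>2) ^ R < \<delta>"
    using \<delta> by (intro order_tendstoD(2)) auto
  then obtain R0 where R0: "\<And>R. R \<ge> R0 \<Longrightarrow> c * (real d / (real s)\<^sup>2) ^ R < \<delta>"
    by (auto simp: eventually_sequentially)
  define R where "R = Suc R0"
  have R: "R > 0" "c * (real d / (real s)\<^sup>2) ^ R < \<delta>" using R0[of R] by (simp_all add: R_def)
  \<comment> \<open>\<open>M\<close> bounds the total mass of the test function, the factor 2 being
    the largest size of \<open>{u, v}\<close>. \<open>N\<close> is then large enough for the mass
    condition of \<open>lambda_2_adjacency_gt\<close>.\<close>
  define M where "M = (real d + 1) ^ R * 2"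
  define N where "N = max 2 (Suc (nat \<lceil>(real d - \<mu>) * M\<^sup>2 / \<delta>\<rceil>))"
  show thesis
  proof (rule that[of N])
    fix n \<pi> u v
    assume n: "n \<ge> N" and perm: "\<And>j. j \<in> {1..d div 2} \<Longrightarrow> \<pi> j permutes {0..<n}"
      and uv: "u < n" "v < n" and swap: "\<And>j. j \<in> {1..m} \<Longrightarrow> \<pi> j u = v \<and> \<pi> j v = u"
    let ?H = "half_edges (d div 2)"
    have cH: "card ?H = d" using d by simp
    interpret rooted_multigraph "{0..<n}" ?H "neighbour \<pi>" "{u, v}" "half_edges m" s
    proof
      show "neighbour \<pi> h x \<in> {0..<n}" if "h \<in> ?H" "x \<in> {0..<n}" for h x
        using permutes_in_image[OF neighbour_permutes[OF perm that(1)]] that(2) by simp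
      show "\<exists>h'\<in>?H. neighbour \<pi> h' (neighbour \<pi> h x) = x" if hx: "h \<in> ?H" "x \<in> {0..<n}" for h x
      proof -
        obtain j b where h: "h = (j, b)" "j \<in> {1..d div 2}" using hx by (auto simp: half_edges_def)
        then have "(j, \<not> b) \<in> ?H" by (simp add: half_edges_def)
        moreover have "neighbour \<pi> (j, \<not> b) (neighbour \<pi> h x) = x"
          using permutes_inverses[OF perm[OF h(2)]] by (simp add: h(1))
        ultimately show ?thesis by blast
      qed
      show "half_edges m \<subseteq> ?H" using md by (auto simp: half_edges_def)
      show "card (half_edges m) = s + 1" using m by (simp add: s_def)
      show "neighbour \<pi> h x \<in> {u, v}" if h: "h \<in> half_edges m" and x: "x \<in> {u, v}" for h x
      proof -
        obtain j b where j: "h = (j, b)" "j \<in> {1..m}" using h by (auto simp: half_edges_def)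
        then have "\<pi> j permutes {0..<n}" using md by (intro perm) auto
        then have "Hilbert_Choice.inv (\<pi> j) u = v" "Hilbert_Choice.inv (\<pi> j) v = u"
          using swap[OF j(2)] by (simp_all add: permutes_inv_eq)
        then show ?thesis using x swap[OF j(2)] by (auto simp: j(1))
      qed
    qed (use uv s in auto)
    have card_S: "1 \<le> card {u, v}" "card {u, v} \<le> 2" by (auto simp: card_insert_if)
    show "lambda 2 (adjacency_of_perms n d \<pi>) > 2 * sqrt (real d - 1)"
      unfolding \<mu>_def[symmetric]
    proof (rule lambda_2_adjacency_gt[OF _ _ d(2) \<mu>d _ _ \<delta>])
      show "\<pi> j permutes {0..<n}" if "j \<in> {1..d div 2}" for j by (rule perm[OF that])
      show "n \<ge> 2" using n by (simp add: N_def)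
      have "?H \<noteq> {}" using cH d(1) by force
      note form = decay_quadratic_form[OF R(1) this]
      show norm: "1 \<le> (\<Sum>u<n. (decay R u)\<^sup>2)"
        using sum_decay_sq_ge[of R] card_S(1) by (simp add: lessThan_atLeast0)
      have "\<mu> + \<delta> \<le> s + c * (1 - (real d / (real s)\<^sup>2) ^ R)"
        using R(2) by (simp add: \<delta>_def field_simps)
      then have "(\<mu> + \<delta>) * (\<Sum>u<n. (decay R u)\<^sup>2) \<le>
          (s + c * (1 - (real d / (real s)\<^sup>2) ^ R)) * (\<Sum>u<n. (decay R u)\<^sup>2)"
        using norm by (intro mult_right_mono) auto
      also have "\<dots> \<le> (\<Sum>u<n. decay R u * (\<Sum>h\<in>?H. decay R (neighbour \<pi> h u)))"
        using form by (simp add: cH c_def lessThan_atLeast0 del: card_half_edges)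
      finally show "(\<mu> + \<delta>) * (\<Sum>u<n. (decay R u)\<^sup>2) \<le>
        (\<Sum>u<n. decay R u * (\<Sum>h\<in>?H. decay R (neighbour \<pi> h u)))" .
      have "(\<Sum>u<n. decay R u) \<le> (real d + 1) ^ R * card {u, v}"
        using sum_decay_le[of R] by (simp add: cH lessThan_atLeast0 del: card_half_edges)
      also have "\<dots> \<le> M" unfolding M_def using card_S(2) by (intro mult_left_mono) auto
      finally have "(\<Sum>u<n. decay R u)\<^sup>2 \<le> M\<^sup>2"
        by (intro power_mono sum_nonneg decay_nonneg)
      then have "(real d - \<mu>) * (\<Sum>u<n. decay R u)\<^sup>2 \<le> (real d - \<mu>) * M\<^sup>2"
        using \<mu>d by (intro mult_left_mono) auto
      also have "\<dots> < \<delta> * n"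
      proof -
        have "(real d - \<mu>) * M\<^sup>2 / \<delta> < n" using n unfolding N_def by linarith
        then show ?thesis using \<delta> by (simp add: field_simps)
      qed
      finally show "(real d - \<mu>) * (\<Sum>u<n. decay R u)\<^sup>2 < \<delta> * n" .
    qed
  qed
qed

subsection \<open>Probability of a fixed vertex or a swapped pair\<close>

text \<open>Composition with \<open>p0\<close> reduces to permutations fixing \<open>S\<close>
  pointwise, which are the permutations of \<open>N - S\<close>.\<close>

lemma card_permutes_agreeing:
  assumes "finite N" "S \<subseteq> N" and p0: "p0 permutes N"
  shows "card {p. p permutes N \<and> (\<forall>x\<in>S. p x = p0 x)} = fact (card N - card S)"
proof -
  have "bij_betw ((\<circ>) p0) {q. q permutes N - S} {p. p permutes N \<and> (\<forall>x\<in>S. p x = p0 x)}"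
  proof (rule bij_betw_byWitness[where f' = "(\<circ>) (Hilbert_Choice.inv p0)"])
    show "\<forall>q\<in>{q. q permutes N - S}. Hilbert_Choice.inv p0 \<circ> (p0 \<circ> q) = q"
      "\<forall>p\<in>{p. p permutes N \<and> (\<forall>x\<in>S. p x = p0 x)}. p0 \<circ> (Hilbert_Choice.inv p0 \<circ> p) = p"
      by (simp_all add: o_assoc permutes_inv_o[OF p0])
    show "(\<circ>) p0 ` {q. q permutes N - S} \<subseteq> {p. p permutes N \<and> (\<forall>x\<in>S. p x = p0 x)}"
      using permutes_compose[OF permutes_subset[of _ "N - S" N] p0]
      by (auto simp: permutes_not_in)
    show "(\<circ>) (Hilbert_Choice.inv p0) ` {p. p permutes N \<and> (\<forall>x\<in>S. p x = p0 x)} \<subseteq> {q. q permutes N - S}"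
      using permutes_compose[OF _ permutes_inv[OF p0]] permutes_inverses[OF p0]
      by (auto intro!: permutes_superset[of _ N "N - S"])
  qed
  then have "card {p. p permutes N \<and> (\<forall>x\<in>S. p x = p0 x)} = card {q. q permutes N - S}"
    by (rule bij_betw_same_card[symmetric])
  also have "\<dots> = fact (card N - card S)"
    using assms by (intro card_permutations) (auto simp: card_Diff_subset finite_subset)
  finally show ?thesis .
qed

lemma prob_permutation_agreeing:
  assumes "S \<subseteq> {0..<n}" "p0 permutes {0..<n}"
  shows "measure_pmf.prob (pmf_of_set {p. p permutes {0..<n}}) {p. \<forall>x\<in>S. p x = p0 x}
    = fact (n - card S) / fact n"
proof -
  have "{p. p permutes {0..<n}} \<noteq> {}" using permutes_id by blast
  then show ?thesis
    using card_permutes_agreeing[OF _ assms]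
    by (simp add: measure_pmf_of_set finite_permutations Collect_conj_eq[symmetric]
        card_permutations[OF _ finite_atLeastLessThan])
qed

lemma prob_random_perms_agreeing:
  assumes "S \<subseteq> {0..<n}" "p0 permutes {0..<n}" "m \<le> d div 2"
  shows "measure_pmf.prob (random_perms n d) {\<pi>. \<forall>j\<in>{1..m}. \<forall>x\<in>S. \<pi> j x = p0 x}
    = (fact (n - card S) / fact n) ^ m"
proof -
  \<comment> \<open>Indices beyond \<open>m\<close> are unconstrained and contribute factors 1 to
    the product given by independence.\<close>
  let ?B = "\<lambda>j. if j \<le> m then {p. \<forall>x\<in>S. p x = p0 x} else UNIV"
  let ?P = "pmf_of_set {p. p permutes {0..<n}}"
  have "{\<pi>. \<forall>j\<in>{1..m}. \<forall>x\<in>S. \<pi> j x = p0 x} = Pi {1..d div 2} ?B"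
    using assms(3) by (auto simp: Pi_def)
  then have "measure_pmf.prob (random_perms n d) {\<pi>. \<forall>j\<in>{1..m}. \<forall>x\<in>S. \<pi> j x = p0 x}
      = (\<Prod>j=1..d div 2. measure_pmf.prob ?P (?B j))"
    by (simp add: random_perms_def measure_Pi_pmf_Pi)
  also have "\<dots> = (\<Prod>j=1..m. measure_pmf.prob ?P (?B j))"
    using assms(3) by (intro prod.mono_neutral_right) auto
  also have "\<dots> = (\<Prod>j=1..m. fact (n - card S) / fact n)"
    using prob_permutation_agreeing[OF assms(1,2)] by (intro prod.cong) auto
  finally show ?thesis by simp
qed

text \<open>Each new event adds its measure minus its overlap with the previous union, and that
  overlap is at most the sum of the pairwise ones. The double sum runs over ordered pairs, hence the
  division by 2.\<close>

lemma (in finite_measure) bonferroni_lower: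
  assumes "finite I" "\<And>i. i \<in> I \<Longrightarrow> A i \<in> sets M"
  shows "measure M (\<Union>i\<in>I. A i) \<ge>
    (\<Sum>i\<in>I. measure M (A i)) - (\<Sum>i\<in>I. \<Sum>j\<in>I - {i}. measure M (A i \<inter> A j)) / 2"
  using assms
proof (induction I)
  case (insert k I)
  let ?U = "\<Union>i\<in>I. A i" and ?m = "\<lambda>i j. measure M (A i \<inter> A j)"
  have sets: "?U \<in> sets M" "A k \<in> sets M" using insert by auto
  have "measure M (A k \<inter> ?U) = measure M (\<Union>i\<in>I. A k \<inter> A i)" by (simp only: Int_UN_distrib)
  also have "\<dots> \<le> (\<Sum>i\<in>I. ?m k i)"
    using insert by (intro finite_measure_subadditive_finite) auto
  finally have inter: "measure M (A k \<inter> ?U) \<le> (\<Sum>i\<in>I. ?m k i)" .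
  have "measure M (A k \<union> ?U) = measure M (A k) + measure M ?U - measure M (A k \<inter> ?U)"
    using sets by (simp add: measure_Un3 fmeasurable_eq_sets)
  moreover have "(\<Sum>i\<in>insert k I. \<Sum>j\<in>insert k I - {i}. ?m i j) =
      (\<Sum>j\<in>I. ?m k j) + (\<Sum>i\<in>I. ?m i k + (\<Sum>j\<in>I - {i}. ?m i j))"
  proof -
    have "insert k I - {i} = insert k (I - {i})" if "i \<in> I" for i using that insert(2) by auto
    then show ?thesis using insert(1,2) by (simp add: insert_Diff_if)
  qed
  moreover have "(\<Sum>i\<in>I. ?m i k) = (\<Sum>j\<in>I. ?m k j)" by (simp add: Int_commute)
  ultimately show ?case
    using insert inter by (simp add: sum.distrib field_simps)
qed simp

section \<open>Swap events and their second-order inclusion-exclusion bound\<close>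

definition swap_event :: "nat \<Rightarrow> nat \<times> nat \<Rightarrow> (nat \<Rightarrow> nat \<Rightarrow> nat) set" where
  "swap_event m = (\<lambda>(u, v). {\<pi>. \<forall>j\<in>{1..m}. \<pi> j u = v \<and> \<pi> j v = u})"

text \<open>The diagonal is included on purpose: \<open>(u, u)\<close> stands for the event that
  \<open>u\<close> is a common fixed point.\<close>

definition unordered_pairs :: "nat \<Rightarrow> (nat \<times> nat) set" where
  "unordered_pairs n = {(u, v). u \<le> v \<and> v < n}"

abbreviation support :: "nat \<times> nat \<Rightarrow> nat set" where
  "support i \<equiv> {fst i, snd i}"

lemma unordered_pairs_split:
  "unordered_pairs n = (\<lambda>u. (u, u)) ` {..<n} \<union> (SIGMA v:{..<n}. {..<v})\<inverse>"
  by (auto simp: unordered_pairs_def)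

lemma finite_unordered_pairs: "finite (unordered_pairs n)"
  by (simp add: unordered_pairs_split)

text \<open>The probability estimates depend only on support sizes, so sums over events reduce to
  counting supports of size 1 and 2.\<close>

lemma sum_unordered_pairs:
  fixes g :: "nat \<Rightarrow> real"
  shows "(\<Sum>i\<in>unordered_pairs n. g (card (support i))) = n * g 1 + real n * (real n - 1) / 2 * g 2"
proof -
  have diag: "(\<Sum>i\<in>(\<lambda>u. (u, u)) ` {..<n}. g (card (support i))) = n * g 1"
    by (subst sum.reindex) (auto simp: inj_on_def)
  have "card ((SIGMA v:{..<n}. {..<v})\<inverse>) = (\<Sum>v<n. v)"
    by (simp add: card_inverse)
  moreover have "real (\<Sum>v<n. v) = real n * (real n - 1) / 2"
    by (induction n) (auto simp: field_simps)
  ultimately have "real (card ((SIGMA v:{..<n}. {..<v})\<inverse>)) = real n * (real n - 1) / 2" by simp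
  moreover have "(\<Sum>i\<in>(SIGMA v:{..<n}. {..<v})\<inverse>. g (card (support i)))
      = (\<Sum>i\<in>(SIGMA v:{..<n}. {..<v})\<inverse>. g 2)"
    by (intro sum.cong) (auto simp: numeral_2_eq_2)
  ultimately have "(\<Sum>i\<in>(SIGMA v:{..<n}. {..<v})\<inverse>. g (card (support i))) = real n * (real n - 1) / 2 * g 2"
    by simp
  then show ?thesis
    unfolding unordered_pairs_split by (subst sum.union_disjoint) (auto simp: diag)
qed

text \<open>The event prescribes agreement with the transposition of \<open>u\<close> and
  \<open>v\<close> on the support; for \<open>u = v\<close> this transposition is the
  identity.\<close>

lemma prob_swap_event:
  assumes "i \<in> unordered_pairs n" "m \<le> d div 2"
  shows "measure_pmf.prob (random_perms n d) (swap_event m i)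
    = (fact (n - card (support i)) / fact n) ^ m"
proof -
  obtain u v where i: "i = (u, v)" "u < n" "v < n"
    using assms(1) by (auto simp: unordered_pairs_def)
  have "swap_event m i = {\<pi>. \<forall>j\<in>{1..m}. \<forall>x\<in>support i. \<pi> j x = Transposition.transpose u v x}"
    by (auto simp: swap_event_def i(1))
  then show ?thesis
    using prob_random_perms_agreeing[of "support i" n "Transposition.transpose u v" m d] assms(2) i
    by (simp add: permutes_swap_id)
qed

text \<open>For disjoint supports the events together prescribe agreement with a product of two
  transpositions. If the supports meet, the events exclude each other, because the image of a common
  vertex determines its partner.\<close>

lemma prob_swap_event_Int_le:
  assumes I: "i \<in> unordered_pairs n" "i' \<in> unordered_pairs n" "i \<noteq> i'" and m: "1 \<le> m" "m \<le> d div 2"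
  shows "measure_pmf.prob (random_perms n d) (swap_event m i \<inter> swap_event m i')
    \<le> (fact (n - (card (support i) + card (support i'))) / fact n) ^ m"
proof -
  obtain u v where i: "i = (u, v)" "u \<le> v" "v < n" using I(1) by (auto simp: unordered_pairs_def)
  obtain u' v' where i': "i' = (u', v')" "u' \<le> v'" "v' < n"
    using I(2) by (auto simp: unordered_pairs_def)
  show ?thesis
  proof (cases "support i \<inter> support i' = {}")
    case True
    let ?p = "Transposition.transpose u v \<circ> Transposition.transpose u' v'"
    have "swap_event m i \<inter> swap_event m i' =
        {\<pi>. \<forall>j\<in>{1..m}. \<forall>x\<in>support i \<union> support i'. \<pi> j x = ?p x}"
      using True by (auto simp: swap_event_def i(1) i'(1) Transposition.transpose_def)
    moreover have "?p permutes {0..<n}"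
      using i i' by (intro permutes_compose permutes_swap_id) auto
    moreover have "card (support i \<union> support i') = card (support i) + card (support i')"
      using True by (intro card_Un_disjoint) auto
    ultimately show ?thesis
      using prob_random_perms_agreeing[of "support i \<union> support i'" n ?p m d] m(2) i i' by simp
  next
    case False
    have "swap_event m i \<inter> swap_event m i' = {}"
    proof (rule ccontr)
      assume "swap_event m i \<inter> swap_event m i' \<noteq> {}"
      then obtain \<pi> where "\<pi> 1 u = v" "\<pi> 1 v = u" "\<pi> 1 u' = v'" "\<pi> 1 v' = u'"
        using m(1) by (force simp: swap_event_def i(1) i'(1))
      then show False using False I(3) i i' by auto
    qed
    then show ?thesis by simp
  qed
qed

text \<open>For distinct \<open>u\<close>, \<open>v\<close>, the event that both are fixed by the first \<open>m\<close> permutations has the same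
  probability as the event that they are swapped. So the pairs of diagonal events in the second
  Bonferroni sum cancel against the off-diagonal events in the first one.\<close>

lemma prob_Union_swap_event_ge:
  assumes m: "2 \<le> m" "m \<le> d div 2" and n: "n \<ge> 17"
  shows "measure_pmf.prob (random_perms n d) (\<Union>i\<in>unordered_pairs n. swap_event m i)
    \<ge> real n / real n ^ m - 1 / 2 * ((real n)\<^sup>2 / real n ^ (2 * m))"
proof -
  let ?I = "unordered_pairs n" and ?P = "measure_pmf.prob (random_perms n d)"
  let ?A = "swap_event m" and ?k = "\<lambda>i. card (support i)"
  \<comment> \<open>\<open>q k\<close> is the probability that the first \<open>m\<close>
    permutations all take prescribed values at \<open>k\<close> given vertices.\<close>
  define q where "q k = (fact (n - k) / fact n :: real) ^ m" for k
  define c where "c = real n * (real n - 1) / 2"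
  note sum_pairs = sum_unordered_pairs[where n = n, folded c_def]
  have q0: "q k \<ge> 0" for k by (simp add: q_def)
  have "(\<Sum>i\<in>?I. ?P (?A i)) = (\<Sum>i\<in>?I. q (?k i))"
    using prob_swap_event[OF _ m(2)] by (intro sum.cong) (auto simp: q_def)
  then have one: "(\<Sum>i\<in>?I. ?P (?A i)) = n * q 1 + c * q 2"
    using sum_pairs[of q] by simp
  \<comment> \<open>Pairs with overlapping supports receive the same bound although their
    intersection is empty, so that only support sizes enter.\<close>
  have "(\<Sum>i\<in>?I. \<Sum>j\<in>?I - {i}. ?P (?A i \<inter> ?A j)) \<le> (\<Sum>i\<in>?I. \<Sum>j\<in>?I - {i}. q (?k i + ?k j))"
    using prob_swap_event_Int_le[of _ n _ m d] m by (intro sum_mono) (auto simp: q_def)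
  also have "\<dots> = (\<Sum>i\<in>?I. (\<Sum>j\<in>?I. q (?k i + ?k j)) - q (?k i + ?k i))"
    by (intro sum.cong refl) (simp add: sum_diff1 finite_unordered_pairs)
  also have "\<dots> = (\<Sum>i\<in>?I. n * q (?k i + 1) + c * q (?k i + 2) - q (?k i + ?k i))"
    using sum_pairs[of "\<lambda>l. q (k + l)" for k] by simp
  also have "\<dots> = n * (n * q 2 + c * q 3 - q 2) + c * (n * q 3 + c * q 4 - q 4)"
    using sum_pairs[of "\<lambda>k. n * q (k + 1) + c * q (k + 2) - q (k + k)"]
    by (simp add: numeral_eq_Suc)
  also have "\<dots> = (real n * (real n - 1)) * q 2 + 2 * n * c * q 3 + c\<^sup>2 * q 4 - c * q 4"
    by (simp add: algebra_simps power2_eq_square)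
  \<comment> \<open>By \<open>n (n - 1) = 2 c\<close>, half of the first term is exactly the
    \<open>c * q 2\<close> in \<open>one\<close>.\<close>
  also have "\<dots> \<le> 2 * c * q 2 + 2 * n * c * q 3 + c\<^sup>2 * q 4"
    using q0[of 4] n by (simp add: c_def)
  finally have two: "(\<Sum>i\<in>?I. \<Sum>j\<in>?I - {i}. ?P (?A i \<inter> ?A j)) \<le> \<dots>" .
  \<comment> \<open>The terms left over have orders \<open>n^(3 - 3m)\<close> and
    \<open>n^(4 - 4m)\<close>, below \<open>n^(2 - 2m)\<close> because \<open>m\<close> is at least
    2.\<close>
  have rest: "2 * n * c * q 3 + c\<^sup>2 * q 4 \<le> (real n)\<^sup>2 / real n ^ (2 * m)"
  proof -
    define x where "x = 1 / real n"
    have x: "0 < x" using n by (simp add: x_def)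
    \<comment> \<open>The factor \<open>x ^ (2 * m)\<close> is split off below;
      \<open>m \<ge> 2\<close> lets the remaining \<open>m\<close>-th powers be replaced by
      squares.\<close>
    have pow2: "a ^ m \<le> a\<^sup>2" if "0 \<le> a" "a \<le> 1" for a :: real
      using that m(1) by (rule power_decreasing[rotated])
    define k where "k = n - 4"
    then have k: "n = k + 4" using n by simp
    have f3: "(fact n :: real) = real n * (real n - 1) * (real n - 2) * fact (n - 3)"
      by (simp add: k numeral_eq_Suc algebra_simps)
    have f4: "(fact (n - 3) :: real) = (real n - 3) * fact (n - 4)"
      by (simp add: k numeral_eq_Suc algebra_simps)
    have "fact (n - 3) / fact n = 1 / (real n * (real n - 1) * (real n - 2))"
      unfolding f3 by simp
    also have "\<dots> \<le> 1 / (real n * (real n / 2) * (real n / 2))"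
      using n by (intro divide_left_mono mult_mono mult_pos_pos) auto
    also have "\<dots> = 4 * x * x\<^sup>2" using n by (simp add: x_def power2_eq_square)
    finally have "q 3 \<le> (4 * x * x\<^sup>2) ^ m" unfolding q_def by (intro power_mono) auto
    also have "\<dots> = (4 * x) ^ m * x ^ (2 * m)" by (simp add: power_mult power_mult_distrib)
    also have "\<dots> \<le> (4 * x)\<^sup>2 * x ^ (2 * m)"
      using x n by (intro mult_right_mono pow2) (auto simp: x_def)
    finally have q3: "q 3 \<le> 16 * x\<^sup>2 * x ^ (2 * m)" by (simp add: power_mult_distrib)
    have "fact (n - 4) / fact n = 1 / (real n * (real n - 1) * (real n - 2) * (real n - 3))"
      unfolding f3 f4 by simp
    also have "\<dots> \<le> 1 / (real n * (real n / 2) * (real n / 2) * (real n / 2))"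
      using n by (intro divide_left_mono mult_mono mult_pos_pos) auto
    also have "\<dots> = 8 * x\<^sup>2 * x\<^sup>2" using n by (simp add: x_def power2_eq_square)
    finally have "q 4 \<le> (8 * x\<^sup>2 * x\<^sup>2) ^ m" unfolding q_def by (intro power_mono) auto
    also have "\<dots> = (8 * x\<^sup>2) ^ m * x ^ (2 * m)" by (simp add: power_mult power_mult_distrib)
    also have "\<dots> \<le> (8 * x\<^sup>2)\<^sup>2 * x ^ (2 * m)"
    proof (intro mult_right_mono pow2)
      have "8 * 1 \<le> real n * real n" using n by (intro mult_mono) auto
      then show "8 * x\<^sup>2 \<le> 1" using n by (simp add: x_def power2_eq_square field_simps)
    qed (use x in auto)
    finally have q4: "q 4 \<le> 64 * x ^ 4 * x ^ (2 * m)" by (simp add: power_mult_distrib)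
    have c_le: "0 \<le> c" "c \<le> (real n)\<^sup>2 / 2" using n by (auto simp: c_def power2_eq_square)
    have "2 * n * c * q 3 + c\<^sup>2 * q 4 \<le>
      2 * n * ((real n)\<^sup>2 / 2) * (16 * x\<^sup>2 * x ^ (2 * m)) + ((real n)\<^sup>2 / 2)\<^sup>2 * (64 * x ^ 4 * x ^ (2 * m))"
      using c_le q3 q4 q0 by (intro add_mono mult_mono power_mono) auto
    also have "\<dots> = (16 * n + 16) * x ^ (2 * m)"
      using n by (simp add: x_def field_simps eval_nat_numeral)
    also have "\<dots> \<le> (real n)\<^sup>2 * x ^ (2 * m)"
    proof (rule mult_right_mono)
      \<comment> \<open>The threshold 17 comes from here:
        \<open>16 n + 16 \<le> 17 n \<le> n^2\<close>.\<close>
      have "17 * real n \<le> real n * real n" using n by (intro mult_right_mono) auto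
      then show "real (16 * n + 16) \<le> (real n)\<^sup>2" using n unfolding power2_eq_square by linarith
    qed (use x in simp)
    finally show ?thesis by (simp add: x_def power_one_over)
  qed
  have "(fact n :: real) = real n * fact (n - 1)" using n by (simp add: fact_reduce)
  then have "q 1 = 1 / real n ^ m" by (simp add: q_def power_one_over)
  then have "real n / real n ^ m - 1 / 2 * ((real n)\<^sup>2 / real n ^ (2 * m)) \<le>
      (\<Sum>i\<in>?I. ?P (?A i)) - (\<Sum>i\<in>?I. \<Sum>j\<in>?I - {i}. ?P (?A i \<inter> ?A j)) / 2"
    using one two rest by (simp add: field_simps)
  also have "\<dots> \<le> ?P (\<Union>i\<in>?I. ?A i)"
    by (rule measure_pmf.bonferroni_lower[OF finite_unordered_pairs]) simp
  finally show ?thesis .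
qed

section \<open>Transfer from permutations to the random graph\<close>

theorem theorem2p11:
  fixes m d :: nat
  assumes "m \<ge> 1" and "d \<ge> 4" and "even d"
    and "2 * real m - 1 > sqrt (real d - 1)"
    and "real m \<le> real d / 2"
  shows "\<exists>N. \<forall>n\<ge>N.
    measure_pmf.prob (random_regular_graph n d) {G. lambda 2 G > 2 * sqrt (real d - 1)}
      \<ge> real n powi (1 - int m) - 1 / 2 * real n powi (2 - 2 * int m)"
proof -
  have md: "m \<le> d div 2" using assms(3,5) by (auto elim!: evenE)
  \<comment> \<open>For \<open>m = 1\<close> the spectral hypothesis would read
    \<open>1 > sqrt (d - 1)\<close>, contradicting \<open>d \<ge> 4\<close>.\<close>
  have m: "2 \<le> m"
  proof (rule ccontr)
    assume "\<not> 2 \<le> m"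
    then have "m = 1" using assms(1) by simp
    then have "sqrt (real d - 1) < 1" using assms(4) by simp
    then show False using assms(2) by simp
  qed
  obtain N where N: "\<And>n \<pi> u v. n \<ge> N \<Longrightarrow> (\<And>j. j \<in> {1..d div 2} \<Longrightarrow> \<pi> j permutes {0..<n}) \<Longrightarrow>
    u < n \<Longrightarrow> v < n \<Longrightarrow> (\<And>j. j \<in> {1..m} \<Longrightarrow> \<pi> j u = v \<and> \<pi> j v = u) \<Longrightarrow>
    lambda 2 (adjacency_of_perms n d \<pi>) > 2 * sqrt (real d - 1)"
    using lambda_2_gt_if_tangle[OF assms(1-4) md] by metis
  show ?thesis
  proof (intro exI[of _ "max N 17"] allI impI)
    fix n assume n: "n \<ge> max N 17"
    let ?L = "{G. lambda 2 G > 2 * sqrt (real d - 1)}"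
    let ?U = "\<Union>i\<in>unordered_pairs n. swap_event m i"
    have "real n powi (1 - int m) - 1 / 2 * real n powi (2 - 2 * int m)
        = real n / real n ^ m - 1 / 2 * ((real n)\<^sup>2 / real n ^ (2 * m))"
    proof -
      have "real n powi (2 - 2 * int m) = real n powi (int 2 - int (2 * m))" by simp
      also have "\<dots> = (real n)\<^sup>2 / real n ^ (2 * m)"
        using n by (subst power_int_diff) (simp_all only: power_int_of_nat, auto)
      finally show ?thesis using n by (simp add: power_int_diff)
    qed
    also have "\<dots> \<le> measure_pmf.prob (random_perms n d) ?U"
      using prob_Union_swap_event_ge[OF m md] n by simp
    also have "\<dots> \<le> measure_pmf.prob (random_perms n d) (adjacency_of_perms n d -` ?L)"
    proof (rule measure_pmf.finite_measure_mono_AE)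
      \<comment> \<open>The inclusion is claimed almost surely, since the components of
        \<open>\<pi>\<close> are known to be permutations only on the support of the
        distribution.\<close>
      show "AE \<pi> in random_perms n d. \<pi> \<in> ?U \<longrightarrow> \<pi> \<in> adjacency_of_perms n d -` ?L"
        unfolding AE_measure_pmf_iff
      proof (intro ballI impI)
        fix \<pi> assume \<pi>: "\<pi> \<in> set_pmf (random_perms n d)" "\<pi> \<in> ?U"
        have "{p. p permutes {0..<n}} \<noteq> {}" using permutes_id by blast
        then have perm: "\<pi> j permutes {0..<n}" if "j \<in> {1..d div 2}" for j
          using \<pi>(1) that
          by (auto simp: random_perms_def set_Pi_pmf PiE_dflt_def set_pmf_of_set finite_permutations)
        obtain u v where uv: "u \<le> v" "v < n" "\<pi> \<in> swap_event m (u, v)"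
          using \<pi>(2) by (auto simp: unordered_pairs_def)
        have "lambda 2 (adjacency_of_perms n d \<pi>) > 2 * sqrt (real d - 1)"
          by (rule N[of n \<pi> u v, OF _ perm]) (use n uv in \<open>auto simp: swap_event_def\<close>)
        then show "\<pi> \<in> adjacency_of_perms n d -` ?L" by simp
      qed
    qed simp
    finally show "real n powi (1 - int m) - 1 / 2 * real n powi (2 - 2 * int m)
        \<le> measure_pmf.prob (random_regular_graph n d) ?L"
      by (simp add: random_regular_graph_def)
  qed
qed

end
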